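(* Let $X$ be a non-negative random variable with $a:=\mathbb{E}X\in(0,\infty)$, and let $c\in(0,\infty)$. Assume that $X$ admits a $c$-bounded size bias coupling. For a real number $x$ put $k=\left\lfloor \frac{|x-a|}{c}\right\rfloor$, so that $k$ is a non-negative integer (possibly zero). Then: for every $x\ge a$, $$\mathbb{P}(X\ge x)\ \le\ \prod_{0\le i\le k}\frac{a}{x-ic},$$ and for every $x$ with $0\le x\le a$, $$\mathbb{P}(X\le x)\ \le\ \prod_{0<i\le k}\frac{x+ic}{a},$$ where the products run over integers $i$ and an empty product equals $1$.
   Context: For a non-negative random variable $X$ with $0<\mathbb{E}X<\infty$, a random variable $Y$ is said to have the size biased distribution of $X$, written $Y=^d X^*$, if $\mathbb{P}(Y\in dx)/\mathbb{P}(X\in dx)=x/\mathbb{E}X$ (Radon–Nikodym derivative), i.e. $\mathbb{E}\,g(Y)=\mathbb{E}(Xg(X))/\mathbb{E}X$ for all bounded measurable $g$. A coupling of $X$ and $Y$ is a realization of random variables with the distributions of $X$ and $Y$ on a common probability space. We say that $X$ admits a $c$-bounded size bias coupling if there is a coupling of $X$ with $Y=^dX^*$ in which $Y\le X+c$ almost surely. *)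

theory Defs
  imports "HOL-Probability.Probability"
begin

text \<open>
  The law of \<open>X\<^sup>*\<close>: it has Radon-Nikodym derivative \<open>x / \<bbbE>X\<close> with respect to the law of \<open>X\<close>.
  This is meaningful for \<open>X \<ge> 0\<close> almost surely and \<open>0 < \<bbbE>X < \<infinity>\<close>; then \<open>ennreal\<close>, which
  sends negative numbers to \<open>0\<close>, changes the density only on a null set.
\<close>

definition size_bias_distr :: "'a measure \<Rightarrow> ('a \<Rightarrow> real) \<Rightarrow> real measure" where
  "size_bias_distr M X =
     density (distr M borel X) (\<lambda>x. ennreal (x / prob_space.expectation M X))"

definition is_coupling ::
  "real measure \<Rightarrow> real measure \<Rightarrow> 'b measure \<Rightarrow> ('b \<Rightarrow> real) \<Rightarrow> ('b \<Rightarrow> real) \<Rightarrow> bool" where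
  "is_coupling \<mu> \<nu> N U V \<longleftrightarrow>
     prob_space N \<and> U \<in> borel_measurable N \<and> V \<in> borel_measurable N \<and>
     distr N borel U = \<mu> \<and> distr N borel V = \<nu>"

text \<open>
  A definition cannot quantify existentially over types, so the type \<open>'b\<close> of the sample points of
  the common probability space is a parameter. A theorem that assumes this predicate for an
  arbitrary \<open>'b\<close> therefore covers couplings on every probability space.
\<close>

definition admits_bounded_size_bias_coupling ::
  "'b itself \<Rightarrow> 'a measure \<Rightarrow> ('a \<Rightarrow> real) \<Rightarrow> real \<Rightarrow> bool" where
  "admits_bounded_size_bias_coupling TYPE('b) M X c \<longleftrightarrow>
     (\<exists>(N :: 'b measure) U V.
        is_coupling (distr M borel X) (size_bias_distr M X) N U V \<and>
        (AE \<omega> in N. V \<omega> \<le> U \<omega> + c))"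

end

theory Submission
  imports Defs
begin

text \<open>
  The link between \<open>X\<close> and its size biased version \<open>Y\<close> is the identity
  \<open>\<bbbE>X \<cdot> P(Y \<in> A) = \<bbbE>(X; X \<in> A)\<close>. On a half line the right-hand side is compared with
  \<open>P(X \<in> A)\<close> by Markov's argument: it is at least \<open>x P(X \<ge> x)\<close> for \<open>A = [x, \<infinity>)\<close> and
  at most \<open>x P(X \<le> x)\<close> for \<open>A = (-\<infinity>, x]\<close>. The left-hand side is compared with a tail of \<open>X\<close>
  by the coupling: \<open>Y \<ge> x\<close> forces \<open>X \<ge> x - c\<close>, and \<open>X \<le> x - c\<close> forces \<open>Y \<le> x\<close>.
  Together these give the two recursions
  \<open>x P(X \<ge> x) \<le> a P(X \<ge> x - c)\<close> and \<open>a P(X \<le> x - c) \<le> x P(X \<le> x)\<close>,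
  where \<open>a = \<bbbE>X\<close>.

  The products come from iterating them and bounding the last probability by \<open>1\<close>. The upper
  recursion can be divided by its factor \<open>x\<close> as long as that is positive, and the choice of
  \<open>k\<close> makes the denominators \<open>x - i c\<close> with \<open>i \<le> k\<close> at least \<open>a\<close>. In the lower recursion, the factors
  \<open>x + i c\<close> are non-negative for \<open>x \<ge> 0\<close>, so it can be iterated any number of times; the
  value \<open>k\<close> in the theorem is the one that uses all factors that are at most \<open>1\<close>.
\<close>

lemma (in prob_space) measure_size_bias_distr:
  assumes X: "X \<in> borel_measurable M" and nonneg: "AE \<omega> in M. 0 \<le> X \<omega>"
    and int: "integrable M X" and pos: "0 < expectation X" and A: "A \<in> sets borel"
  shows "expectation X * measure (size_bias_distr M X) A
           = expectation (\<lambda>\<omega>. X \<omega> * indicator A (X \<omega>))"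
proof -
  let ?a = "expectation X"
  have meas: "{\<omega> \<in> space M. X \<omega> \<in> A} \<in> sets M"
    using X A by measurable
  have "integrable M (\<lambda>\<omega>. X \<omega> * indicator {\<omega> \<in> space M. X \<omega> \<in> A} \<omega>)"
    by (rule integrable_real_mult_indicator[OF meas int])
  also have "?this \<longleftrightarrow> integrable M (\<lambda>\<omega>. X \<omega> * indicator A (X \<omega>))"
    by (intro Bochner_Integration.integrable_cong) (auto simp: indicator_def)
  finally have intA: "integrable M (\<lambda>\<omega>. X \<omega> * indicator A (X \<omega>) / ?a)"
    by simp
  have nonnegA: "AE \<omega> in M. 0 \<le> X \<omega> * indicator A (X \<omega>) / ?a"
    using nonneg pos by (auto simp: indicator_def)
  have "emeasure (size_bias_distr M X) A
          = (\<integral>\<^sup>+x. ennreal (x / ?a) * indicator A x \<partial>distr M borel X)"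
    using A by (simp add: size_bias_distr_def emeasure_density)
  also have "\<dots> = (\<integral>\<^sup>+\<omega>. ennreal (X \<omega> / ?a) * indicator A (X \<omega>) \<partial>M)"
    using X A by (intro nn_integral_distr) auto
  also have "\<dots> = (\<integral>\<^sup>+\<omega>. ennreal (X \<omega> * indicator A (X \<omega>) / ?a) \<partial>M)"
    by (intro nn_integral_cong) (auto simp: indicator_def)
  also have "\<dots> = ennreal (expectation (\<lambda>\<omega>. X \<omega> * indicator A (X \<omega>) / ?a))"
    by (rule nn_integral_eq_integral[OF intA nonnegA])
  finally have "measure (size_bias_distr M X) A
                  = expectation (\<lambda>\<omega>. X \<omega> * indicator A (X \<omega>) / ?a)"
    using integral_nonneg_AE[OF nonnegA] by (simp add: measure_def)
  then show ?thesis
    using pos by simp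
qed

text \<open>
  One step of the iteration, in both directions: size biasing multiplies the mass on a half line
  that ends at \<open>x\<close> by at least, respectively at most, \<open>x / \<bbbE>X\<close>, and the coupling pays for the
  return to the law of \<open>X\<close> with a shift of the half line by \<open>c\<close>.
\<close>

lemma (in prob_space)
  fixes X :: "'a \<Rightarrow> real"
  assumes X: "X \<in> borel_measurable M" and nonneg: "AE \<omega> in M. 0 \<le> X \<omega>"
    and int: "integrable M X" and pos: "0 < expectation X"
    and coupling: "admits_bounded_size_bias_coupling TYPE('b) M X c"
  shows upper_tail_step:
      "x * prob {\<omega> \<in> space M. x \<le> X \<omega>} \<le> expectation X * prob {\<omega> \<in> space M. x - c \<le> X \<omega>}"
    and lower_tail_step:
      "expectation X * prob {\<omega> \<in> space M. X \<omega> \<le> x - c} \<le> x * prob {\<omega> \<in> space M. X \<omega> \<le> x}"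
proof -
  obtain N :: "'b measure" and U V where N: "prob_space N"
    and [measurable]: "U \<in> borel_measurable N" "V \<in> borel_measurable N"
    and distrU: "distr N borel U = distr M borel X"
    and distrV: "distr N borel V = size_bias_distr M X"
    and le: "AE \<omega> in N. V \<omega> \<le> U \<omega> + c"
    using coupling by (auto simp: admits_bounded_size_bias_coupling_def is_coupling_def)
  interpret N: prob_space N by (rule N)
  note X[measurable]
  have law_X: "prob {\<omega> \<in> space M. X \<omega> \<in> A} = N.prob {\<omega> \<in> space N. U \<omega> \<in> A}"
    if "A \<in> sets borel" for A
  proof -
    have "prob {\<omega> \<in> space M. X \<omega> \<in> A} = measure (distr M borel X) A"
      using that by (subst measure_distr) (auto intro!: arg_cong[where f = prob])
    also have "\<dots> = N.prob {\<omega> \<in> space N. U \<omega> \<in> A}"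
      using that unfolding distrU[symmetric]
      by (subst measure_distr) (auto intro!: arg_cong[where f = N.prob])
    finally show ?thesis .
  qed
  have law_V: "expectation X * N.prob {\<omega> \<in> space N. V \<omega> \<in> A}
                 = expectation (\<lambda>\<omega>. X \<omega> * indicator A (X \<omega>))"
    if "A \<in> sets borel" for A
  proof -
    have "N.prob {\<omega> \<in> space N. V \<omega> \<in> A} = measure (size_bias_distr M X) A"
      using that unfolding distrV[symmetric]
      by (subst measure_distr) (auto intro!: arg_cong[where f = N.prob])
    then show ?thesis
      using measure_size_bias_distr[OF X nonneg int pos that] by simp
  qed
  have int_on: "integrable M (\<lambda>\<omega>. X \<omega> * indicator A (X \<omega>))" if "A \<in> sets borel" for A
  proof -
    have "(\<lambda>\<omega>. X \<omega> * indicator A (X \<omega>)) \<in> borel_measurable M"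
      using that by measurable
    then show ?thesis
      by (rule Bochner_Integration.integrable_bound[OF int]) (auto simp: indicator_def)
  qed
  have scaled_prob: "x * prob {\<omega> \<in> space M. X \<omega> \<in> A} = expectation (\<lambda>\<omega>. x * indicator A (X \<omega>))"
    and int_scaled: "integrable M (\<lambda>\<omega>. x * indicator A (X \<omega>))"
    if [measurable]: "A \<in> sets borel" for A
  proof -
    have "{\<omega> \<in> space M. X \<omega> \<in> A} \<in> sets M" by measurable
    then have "has_bochner_integral M (indicator {\<omega> \<in> space M. X \<omega> \<in> A})
                 (prob {\<omega> \<in> space M. X \<omega> \<in> A})"
      by (intro has_bochner_integral_real_indicator) (auto simp: emeasure_eq_measure)
    also have "?this \<longleftrightarrow> has_bochner_integral M (\<lambda>\<omega>. indicator A (X \<omega>))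
                 (prob {\<omega> \<in> space M. X \<omega> \<in> A})"
      by (intro has_bochner_integral_cong) (auto simp: indicator_def)
    finally have "has_bochner_integral M (\<lambda>\<omega>. indicator A (X \<omega>) :: real)
                    (prob {\<omega> \<in> space M. X \<omega> \<in> A})" .
    then show "x * prob {\<omega> \<in> space M. X \<omega> \<in> A} = expectation (\<lambda>\<omega>. x * indicator A (X \<omega>))"
      and "integrable M (\<lambda>\<omega>. x * indicator A (X \<omega>))"
      by (auto simp: has_bochner_integral_iff)
  qed

  have "x * prob {\<omega> \<in> space M. X \<omega> \<in> {x..}} = expectation (\<lambda>\<omega>. x * indicator {x..} (X \<omega>))"
    by (rule scaled_prob) simp
  also have "\<dots> \<le> expectation (\<lambda>\<omega>. X \<omega> * indicator {x..} (X \<omega>))"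
    by (intro integral_mono int_on int_scaled) (auto simp: indicator_def)
  also have "\<dots> = expectation X * N.prob {\<omega> \<in> space N. V \<omega> \<in> {x..}}"
    by (rule law_V[symmetric]) simp
  also have "\<dots> \<le> expectation X * N.prob {\<omega> \<in> space N. U \<omega> \<in> {x - c..}}"
    using pos le
    by (intro mult_left_mono N.finite_measure_mono_AE) (auto elim!: eventually_mono)
  also have "\<dots> = expectation X * prob {\<omega> \<in> space M. X \<omega> \<in> {x - c..}}"
    by (subst law_X) simp_all
  finally show "x * prob {\<omega> \<in> space M. x \<le> X \<omega>}
                  \<le> expectation X * prob {\<omega> \<in> space M. x - c \<le> X \<omega>}"
    by simp

  have "prob {\<omega> \<in> space M. X \<omega> \<in> {..x - c}} = N.prob {\<omega> \<in> space N. U \<omega> \<in> {..x - c}}"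
    by (subst law_X) simp_all
  also have "\<dots> \<le> N.prob {\<omega> \<in> space N. V \<omega> \<in> {..x}}"
    by (rule N.finite_measure_mono_AE) (use le in \<open>auto elim!: eventually_mono\<close>)
  finally have "expectation X * prob {\<omega> \<in> space M. X \<omega> \<in> {..x - c}}
                  \<le> expectation X * N.prob {\<omega> \<in> space N. V \<omega> \<in> {..x}}"
    using pos by simp
  also have "\<dots> = expectation (\<lambda>\<omega>. X \<omega> * indicator {..x} (X \<omega>))"
    by (rule law_V) simp
  also have "\<dots> \<le> expectation (\<lambda>\<omega>. x * indicator {..x} (X \<omega>))"
    by (intro integral_mono int_on int_scaled) (auto simp: indicator_def)
  also have "\<dots> = x * prob {\<omega> \<in> space M. X \<omega> \<in> {..x}}"
    by (rule scaled_prob[symmetric]) simp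
  finally show "expectation X * prob {\<omega> \<in> space M. X \<omega> \<le> x - c}
                  \<le> x * prob {\<omega> \<in> space M. X \<omega> \<le> x}"
    by simp
qed

lemma iterate_upper_step:
  fixes G :: "real \<Rightarrow> real"
  assumes step: "\<And>x. x * G x \<le> a * G (x - c)" and le_1: "\<And>x. G x \<le> 1"
    and "0 < a" and "\<And>i. i \<le> k \<Longrightarrow> 0 < x - real i * c"
  shows "G x \<le> (\<Prod>i\<in>{0..k}. a / (x - real i * c))"
proof -
  have "G x \<le> (\<Prod>i<n. a / (x - real i * c)) * G (x - real n * c)" if "n \<le> Suc k" for n
    using that
  proof (induction n)
    case (Suc n)
    let ?P = "\<Prod>i<n. a / (x - real i * c)"
    have pos: "0 < x - real n * c"
      using assms(4) Suc.prems by simp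
    have "0 \<le> ?P"
      using assms(3,4) Suc.prems by (intro prod_nonneg) (auto intro!: divide_nonneg_pos)
    moreover have "G (x - real n * c) \<le> a / (x - real n * c) * G (x - real (Suc n) * c)"
      using step[of "x - real n * c"] pos by (simp add: field_simps)
    ultimately have "?P * G (x - real n * c)
                       \<le> ?P * (a / (x - real n * c) * G (x - real (Suc n) * c))"
      by (rule mult_left_mono[rotated])
    with Suc show ?case
      by (simp add: mult.assoc)
  qed simp
  from this[of "Suc k"]
  have "G x \<le> (\<Prod>i<Suc k. a / (x - real i * c)) * G (x - real (Suc k) * c)"
    by simp
  also have "\<dots> \<le> (\<Prod>i<Suc k. a / (x - real i * c)) * 1"
    using assms(3,4) le_1
    by (intro mult_left_mono prod_nonneg) (auto intro!: divide_nonneg_pos simp: less_Suc_eq_le)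
  finally show ?thesis
    by (simp add: atLeast0AtMost lessThan_Suc_atMost)
qed

lemma iterate_lower_step:
  fixes F :: "real \<Rightarrow> real"
  assumes step: "\<And>x. a * F (x - c) \<le> x * F x" and le_1: "\<And>x. F x \<le> 1"
    and "0 < a" "0 \<le> c" "0 \<le> x"
  shows "F x \<le> (\<Prod>i\<in>{0<..k}. (x + real i * c) / a)"
proof -
  have nonneg: "0 \<le> (\<Prod>i\<in>{0<..n}. (x + real i * c) / a)" for n
    using assms(3-5) by (intro prod_nonneg) auto
  have "F x \<le> (\<Prod>i\<in>{0<..n}. (x + real i * c) / a) * F (x + real n * c)" for n
  proof (induction n)
    case (Suc n)
    let ?P = "\<Prod>i\<in>{0<..n}. (x + real i * c) / a"
    have "F (x + real n * c) \<le> (x + real (Suc n) * c) / a * F (x + real (Suc n) * c)"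
      using step[of "x + real (Suc n) * c"] \<open>0 < a\<close> by (simp add: field_simps)
    then have "?P * F (x + real n * c)
                 \<le> ?P * ((x + real (Suc n) * c) / a * F (x + real (Suc n) * c))"
      using nonneg by (rule mult_left_mono)
    moreover have "{0<..Suc n} = insert (Suc n) {0<..n}"
      by auto
    ultimately show ?case
      using Suc by (simp add: mult_ac)
  qed simp
  from this[of k] have "F x \<le> (\<Prod>i\<in>{0<..k}. (x + real i * c) / a) * F (x + real k * c)" .
  also have "\<dots> \<le> (\<Prod>i\<in>{0<..k}. (x + real i * c) / a) * 1"
    by (intro mult_left_mono le_1 nonneg)
  finally show ?thesis
    by simp
qed

theorem theorem1p1:
  fixes M :: "'a measure" and X :: "'a \<Rightarrow> real" and a c :: real
  assumes "prob_space M"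
    and "X \<in> borel_measurable M"
    and "AE \<omega> in M. 0 \<le> X \<omega>"
    and "integrable M X"
    and "a = prob_space.expectation M X"
    and "0 < a"
    and "0 < c"
    and "admits_bounded_size_bias_coupling TYPE('b) M X c"
  shows "(\<forall>x\<ge>a. let k = nat \<lfloor>\<bar>x - a\<bar> / c\<rfloor> in
            prob_space.prob M {\<omega> \<in> space M. X \<omega> \<ge> x}
              \<le> (\<Prod>i\<in>{0..k}. a / (x - real i * c))) \<and>
         (\<forall>x. 0 \<le> x \<and> x \<le> a \<longrightarrow> (let k = nat \<lfloor>\<bar>x - a\<bar> / c\<rfloor> in
            prob_space.prob M {\<omega> \<in> space M. X \<omega> \<le> x}
              \<le> (\<Prod>i\<in>{0<..k}. (x + real i * c) / a)))"
proof -
  interpret prob_space M by fact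
  have E_pos: "0 < expectation X"
    using assms(5,6) by simp
  note upper = upper_tail_step[OF assms(2-4) E_pos assms(8), folded assms(5)]
  note lower = lower_tail_step[OF assms(2-4) E_pos assms(8), folded assms(5)]
  have factor_pos: "0 < x - real i * c" if "a \<le> x" and "i \<le> nat \<lfloor>\<bar>x - a\<bar> / c\<rfloor>" for x i
  proof -
    have "real i \<le> (x - a) / c"
      using that \<open>0 < c\<close> by (simp add: le_nat_iff le_floor_iff)
    then have "real i * c \<le> x - a"
      using \<open>0 < c\<close> by (simp add: field_simps)
    then show ?thesis
      using \<open>0 < a\<close> by linarith
  qed
  show ?thesis
    unfolding Let_def
    using iterate_upper_step[OF upper prob_le_1 \<open>0 < a\<close> factor_pos]
      iterate_lower_step[OF lower prob_le_1 \<open>0 < a\<close> less_imp_le[OF \<open>0 < c\<close>]]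
    by blast
qed

end
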